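(* Let $X$ be a regular $T_1$ topological space. If $X\times[0,1]$ is monotonically $\delta$-normal, then $X$ is both monotonically $\delta$-normal and MCP. Moreover, if $X\times[0,1]$ is monotonically $\delta$-normal, then $X\times[0,1]$ is MCP.
   Context: A subset $D$ of a space $X$ is a regular $G_\delta$ if there are open sets $U_n$ ($n\in\omega$), each containing $D$, such that $D=\bigcap_{n\in\omega}\overline{U_n}$. A space $X$ is monotonically $\delta$-normal if there is an operator $H$ assigning to each pair $(C,D)$ of disjoint closed subsets of $X$, at least one of which is a regular $G_\delta$-set, an open set $H(C,D)$ such that: (1) $C\subseteq H(C,D)\subseteq\overline{H(C,D)}\subseteq X\setminus D$; and (2) if $(C,D)$ and $(C',D')$ are two such pairs with $C\subseteq C'$ and $D'\subseteq D$, then $H(C,D)\subseteq H(C',D')$. A space $X$ is MCP (monotonically countably paracompact) if there is an operator $U$ assigning to each $n\in\omega$ and each closed set $D\subseteq X$ an open set $U(n,D)$ such that: (i) $D\subseteq U(n,D)$; (ii) if $E\subseteq D$ are closed, then $U(n,E)\subseteq U(n,D)$; and (iii) if $(D_i)_{i\in\omega}$ is a decreasing sequence of closed sets with empty intersection, then $\bigcap_{n\in\omega}\overline{U(n,D_n)}=\varnothing$. $X\times[0,1]$ carries the product topology, with the usual topology on $[0,1]$. *)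

theory Defs
  imports "HOL-Analysis.Analysis"
begin

definition regular_gdelta_in :: "'a topology \<Rightarrow> 'a set \<Rightarrow> bool" where
  "regular_gdelta_in X D \<longleftrightarrow>
     (\<exists>U :: nat \<Rightarrow> 'a set. (\<forall>n. openin X (U n) \<and> D \<subseteq> U n) \<and> D = (\<Inter>n. X closure_of U n))"

definition delta_normal_pair :: "'a topology \<Rightarrow> 'a set \<Rightarrow> 'a set \<Rightarrow> bool" where
  "delta_normal_pair X C D \<longleftrightarrow>
     closedin X C \<and> closedin X D \<and> disjnt C D \<and> (regular_gdelta_in X C \<or> regular_gdelta_in X D)"

text \<open>The operators below are total functions on sets; only their values on admissible pairs,
  respectively on closed sets, are constrained.\<close>

definition monotonically_delta_normal_space :: "'a topology \<Rightarrow> bool" where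
  "monotonically_delta_normal_space X \<longleftrightarrow>
     (\<exists>H :: 'a set \<Rightarrow> 'a set \<Rightarrow> 'a set.
        (\<forall>C D. delta_normal_pair X C D \<longrightarrow>
           openin X (H C D) \<and> C \<subseteq> H C D \<and> H C D \<subseteq> X closure_of H C D \<and>
           X closure_of H C D \<subseteq> topspace X - D) \<and>
        (\<forall>C D C' D'. delta_normal_pair X C D \<and> delta_normal_pair X C' D' \<and> C \<subseteq> C' \<and> D' \<subseteq> D \<longrightarrow>
           H C D \<subseteq> H C' D'))"

definition monotonically_countably_paracompact_space :: "'a topology \<Rightarrow> bool" where
  "monotonically_countably_paracompact_space X \<longleftrightarrow>
     (\<exists>U :: nat \<Rightarrow> 'a set \<Rightarrow> 'a set.
        (\<forall>n D. closedin X D \<longrightarrow> openin X (U n D) \<and> D \<subseteq> U n D) \<and>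
        (\<forall>n D E. closedin X D \<and> closedin X E \<and> E \<subseteq> D \<longrightarrow> U n E \<subseteq> U n D) \<and>
        (\<forall>D :: nat \<Rightarrow> 'a set. (\<forall>i. closedin X (D i)) \<and> decseq D \<and> (\<Inter>i. D i) = {} \<longrightarrow>
           (\<Inter>n. X closure_of U n (D n)) = {}))"

end

theory Submission
  imports Defs
begin

text \<open>Monotone delta-normality passes from a product to a factor by taking the cylinders over closed
  sets. For countable paracompactness, separate \<open>D \<times> {1/(n+1)}\<close> from the regular G-delta set
  \<open>X \<times> {0}\<close> and let \<open>U(n,D)\<close> be the slice at height \<open>1/(n+1)\<close> of the separating open set. If the
  \<open>D\<^sub>n\<close> decrease to the empty set, then all the sets \<open>D\<^sub>n \<times> {1/(n+1)}\<close> lie in one closed set disjoint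
  from \<open>X \<times> {0}\<close>, so by monotonicity a point \<open>x\<close> in all the closures of \<open>U(n,D\<^sub>n)\<close> would put \<open>(x,0)\<close>
  in the closure of an open set whose closure misses \<open>X \<times> {0}\<close>. Finally, the projection along a compact factor is closed
  and, by compactness of the fibres, maps decreasing sequences of closed sets with empty intersection
  to such sequences.\<close>

lemma regular_gdelta_in_topspace: "regular_gdelta_in X (topspace X)"
  unfolding regular_gdelta_in_def by (rule exI [of _ "\<lambda>_. topspace X"]) auto

text \<open>Closure commutes with binary products, and a point lies in every rectangle exactly when
  its coordinates lie in all the respective sides, so both witnessing sequences can share the index
  \<open>n\<close>.\<close>

lemma regular_gdelta_in_Times:
  assumes "regular_gdelta_in X A" and "regular_gdelta_in Y B"
  shows "regular_gdelta_in (prod_topology X Y) (A \<times> B)"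
proof -
  obtain U :: "nat \<Rightarrow> 'a set" where U: "\<And>n. openin X (U n)" "\<And>n. A \<subseteq> U n"
    and A: "A = (\<Inter>n. X closure_of U n)"
    using assms(1) unfolding regular_gdelta_in_def by auto
  obtain V :: "nat \<Rightarrow> 'b set" where V: "\<And>n. openin Y (V n)" "\<And>n. B \<subseteq> V n"
    and B: "B = (\<Inter>n. Y closure_of V n)"
    using assms(2) unfolding regular_gdelta_in_def by auto
  have "A \<times> B = (\<Inter>n. prod_topology X Y closure_of (U n \<times> V n))"
    unfolding closure_of_Times by (subst A, subst B) auto
  moreover have "openin (prod_topology X Y) (U n \<times> V n) \<and> A \<times> B \<subseteq> U n \<times> V n" for n
    using U V by (simp add: openin_prod_Times_iff Sigma_mono)
  ultimately show ?thesis
    unfolding regular_gdelta_in_def by (intro exI [of _ "\<lambda>n. U n \<times> V n"]) simp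
qed

text \<open>Continuous maps send closures into closures. With \<open>f\<close> the embedding of
  \<open>X\<close> at a fixed height, this bounds the closure of a slice by the slice of the
  closure.\<close>

lemma closure_of_slice_subset:
  assumes "continuous_map X Y f"
  shows "X closure_of {x \<in> topspace X. f x \<in> S} \<subseteq> {x \<in> topspace X. f x \<in> Y closure_of S}"
proof -
  have "f ` {x \<in> topspace X. f x \<in> S} \<subseteq> S"
    by auto
  then have "f ` (X closure_of {x \<in> topspace X. f x \<in> S}) \<subseteq> Y closure_of S"
    using continuous_map_image_closure_subset [OF assms] closure_of_mono by (metis subset_trans)
  then show ?thesis
    using closure_of_subset_topspace by fastforce
qed

lemma continuous_map_Pair_const:
  assumes "y \<in> topspace Y"
  shows "continuous_map X (prod_topology X Y) (\<lambda>x. (x, y))"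
  using assms by (auto intro!: continuous_map_pairedI)

text \<open>Whichever side is a regular G-delta stays one, since \<open>topspace Y\<close> is itself
  a regular G-delta in \<open>Y\<close>.\<close>

lemma delta_normal_pair_cylinder:
  assumes "delta_normal_pair X C D"
  shows "delta_normal_pair (prod_topology X Y) (C \<times> topspace Y) (D \<times> topspace Y)"
  using assms regular_gdelta_in_Times [OF _ regular_gdelta_in_topspace, of X _ Y]
  unfolding delta_normal_pair_def disjnt_def
  by (auto simp: closedin_prod_Times_iff)

lemma monotonically_delta_normal_space_factor:
  assumes "monotonically_delta_normal_space (prod_topology X Y)" and y: "y \<in> topspace Y"
  shows "monotonically_delta_normal_space X"
proof -
  let ?P = "prod_topology X Y"
  obtain H where
    H: "\<And>C D. delta_normal_pair ?P C D \<Longrightarrow>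
          openin ?P (H C D) \<and> C \<subseteq> H C D \<and> ?P closure_of H C D \<subseteq> topspace ?P - D"
    and mono: "\<And>C D C' D'. delta_normal_pair ?P C D \<Longrightarrow> delta_normal_pair ?P C' D' \<Longrightarrow>
          C \<subseteq> C' \<Longrightarrow> D' \<subseteq> D \<Longrightarrow> H C D \<subseteq> H C' D'"
    using assms(1) unfolding monotonically_delta_normal_space_def by metis
  \<comment> \<open>The slice at height \<open>y\<close> of the separating set for the two
    cylinders. Passing to cylinders preserves both inclusions between pairs, so \<open>G\<close>
    inherits monotonicity.\<close>
  define G where
    "G C D = {x \<in> topspace X. (x, y) \<in> H (C \<times> topspace Y) (D \<times> topspace Y)}" for C D
  show ?thesis
    unfolding monotonically_delta_normal_space_def
  proof (intro exI [of _ G] conjI allI impI)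
    fix C D assume CD: "delta_normal_pair X C D"
    note Q = H [OF delta_normal_pair_cylinder [OF CD, of Y]]
    show "openin X (G C D)"
      unfolding G_def
      using openin_continuous_map_preimage [OF continuous_map_Pair_const [OF y]] Q by blast
    show "C \<subseteq> G C D"
      using Q y CD closedin_subset unfolding G_def delta_normal_pair_def by fastforce
    show "G C D \<subseteq> X closure_of G C D"
      by (rule closure_of_subset) (auto simp: G_def)
    show "X closure_of G C D \<subseteq> topspace X - D"
      using closure_of_slice_subset [OF continuous_map_Pair_const [OF y]] Q y
      unfolding G_def by fastforce
  next
    fix C D C' D'
    assume "delta_normal_pair X C D \<and> delta_normal_pair X C' D' \<and> C \<subseteq> C' \<and> D' \<subseteq> D"
    then have "H (C \<times> topspace Y) (D \<times> topspace Y) \<subseteq> H (C' \<times> topspace Y) (D' \<times> topspace Y)"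
      by (intro mono delta_normal_pair_cylinder) auto
    then show "G C D \<subseteq> G C' D'"
      unfolding G_def by auto
  qed
qed

lemma regular_gdelta_in_zero: "regular_gdelta_in (top_of_set {0..1::real}) {0}"
proof -
  let ?I = "top_of_set {0..1::real}"
  \<comment> \<open>The closures of these shrinking neighbourhoods stay in
    \<open>{0..inverse (real (Suc n))}\<close>, and these intervals have only 0 in common.\<close>
  define U where "U n = {0..1} \<inter> {..<inverse (real (Suc n))}" for n
  have U: "openin ?I (U n)" "{0} \<subseteq> U n" "U n \<subseteq> topspace ?I" for n
    by (auto simp: U_def openin_open_Int)
  have upper: "?I closure_of U n \<subseteq> {0..inverse (real (Suc n))}" for n
  proof (rule closure_of_minimal)
    have "{0..1} \<inter> {..inverse (real (Suc n))} = {0..inverse (real (Suc n))}"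
      by (auto simp: field_simps)
    then show "closedin ?I {0..inverse (real (Suc n))}"
      by (metis closed_atMost closedin_closed_Int)
  qed (auto simp: U_def)
  have "t = 0" if t: "t \<in> (\<Inter>n. ?I closure_of U n)" for t
  proof -
    have "0 \<le> t" "t \<le> inverse (real (Suc n))" for n
      using t upper [of n] by (auto simp del: of_nat_Suc)
    then show ?thesis
      using reals_Archimedean [of t] by (meson linorder_not_less order_antisym)
  qed
  moreover have "{0} \<subseteq> ?I closure_of U n" for n
    using closure_of_subset [OF U(3)] U(2) by (rule subset_trans [rotated])
  ultimately have "{0} = (\<Inter>n. ?I closure_of U n)"
    by (intro equalityI INT_greatest) auto
  then show ?thesis
    unfolding regular_gdelta_in_def using U by blast
qed

lemma monotonically_countably_paracompact_space_if_delta_normal_Times_interval: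
  assumes "monotonically_delta_normal_space (prod_topology X (top_of_set {0..1::real}))"
  shows "monotonically_countably_paracompact_space X"
proof -
  let ?I = "top_of_set {0..1::real}"
  let ?P = "prod_topology X ?I"
  define Z where "Z = topspace X \<times> {0::real}"
  \<comment> \<open>Starting at 1 keeps every height inside the interval; positivity keeps the
    levels off \<open>Z\<close>, and they converge to 0.\<close>
  define h where "h n = inverse (real (Suc n))" for n
  have h: "h n \<in> topspace ?I" "h n > 0" for n
    by (auto simp: h_def field_simps)
  have h_antimono: "h n \<le> h m" if "m \<le> n" for m n
    using that by (simp add: h_def)
  have h_lim: "h \<longlonglongrightarrow> 0"
    unfolding h_def by (rule LIMSEQ_inverse_real_of_nat)
  have Z: "closedin ?P Z" "regular_gdelta_in ?P Z"
    unfolding Z_def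
    using regular_gdelta_in_Times [OF regular_gdelta_in_topspace regular_gdelta_in_zero]
    by (auto simp: closedin_prod_Times_iff closed_subset)
  obtain H where
    H: "\<And>C D. delta_normal_pair ?P C D \<Longrightarrow>
          openin ?P (H C D) \<and> C \<subseteq> H C D \<and> ?P closure_of H C D \<subseteq> topspace ?P - D"
    and mono: "\<And>C D C' D'. delta_normal_pair ?P C D \<Longrightarrow> delta_normal_pair ?P C' D' \<Longrightarrow>
          C \<subseteq> C' \<Longrightarrow> D' \<subseteq> D \<Longrightarrow> H C D \<subseteq> H C' D'"
    using assms unfolding monotonically_delta_normal_space_def by metis
  define U where "U n D = {x \<in> topspace X. (x, h n) \<in> H (D \<times> {h n}) Z}" for n D
  \<comment> \<open>The regular G-delta condition is met by \<open>Z\<close>, so \<open>D\<close>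
    may be an arbitrary closed set.\<close>
  have pair: "delta_normal_pair ?P (D \<times> {h n}) Z" if "closedin X D" for D n
    using that h [of n] Z unfolding delta_normal_pair_def Z_def disjnt_def
    by (auto simp: closedin_prod_Times_iff closed_subset)
  show ?thesis
    unfolding monotonically_countably_paracompact_space_def
  proof (intro exI [of _ U] conjI allI impI)
    fix n D assume D: "closedin X D"
    note Q = H [OF pair [OF D, of n]]
    show "openin X (U n D)"
      unfolding U_def
      using openin_continuous_map_preimage [OF continuous_map_Pair_const [OF h(1)]] Q by blast
    show "D \<subseteq> U n D"
      using Q closedin_subset [OF D] unfolding U_def by auto
  next
    fix n D E assume "closedin X D \<and> closedin X E \<and> E \<subseteq> D"
    then have "H (E \<times> {h n}) Z \<subseteq> H (D \<times> {h n}) Z"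
      by (intro mono pair) auto
    then show "U n E \<subseteq> U n D"
      unfolding U_def by auto
  next
    fix D :: "nat \<Rightarrow> 'a set"
    assume "(\<forall>i. closedin X (D i)) \<and> decseq D \<and> (\<Inter>i. D i) = {}"
    then have D: "\<And>i. closedin X (D i)" "decseq D" "(\<Inter>i. D i) = {}"
      by auto
    \<comment> \<open>The \<open>N\<close>-th set requires membership in \<open>D N\<close> only
      below height \<open>h N\<close>. At height 0 all these requirements apply, leaving the empty
      intersection of the \<open>D N\<close>.\<close>
    define E where "E = (\<Inter>N. D N \<times> {0..1} \<union> topspace X \<times> {h N..1})"
    have "{h N..1} \<subseteq> {0..1}" for N
      using h(2) [of N] by auto
    then have "closedin ?P E"
      unfolding E_def
      by (intro closedin_INT closedin_Un) (auto simp: closedin_prod_Times_iff D(1) closed_subset)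
    moreover have "disjnt E Z"
    proof -
      have False if "(x, 0) \<in> E" for x
      proof -
        have "x \<in> D N" for N
          using that h(2) [of N] unfolding E_def by force
        then show False
          using D(3) by blast
      qed
      then show ?thesis
        unfolding disjnt_def Z_def by auto
    qed
    ultimately have E: "delta_normal_pair ?P E Z"
      unfolding delta_normal_pair_def using Z by auto
    \<comment> \<open>For \<open>N \<le> n\<close> use that \<open>D\<close> decreases; for
      \<open>N > n\<close> the height \<open>h n\<close> is already at least
      \<open>h N\<close>.\<close>
    have DE: "D n \<times> {h n} \<subseteq> E" for n
    proof -
      have "D n \<times> {h n} \<subseteq> D N \<times> {0..1} \<union> topspace X \<times> {h N..1}" for N
      proof (cases "N \<le> n")
        case True
        then show ?thesis using decseqD [OF D(2) True] h(1) [of n] by auto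
      next
        case False
        then show ?thesis
          using h_antimono [of n N] h(1) [of n] closedin_subset [OF D(1), of n] by auto
      qed
      then show ?thesis
        unfolding E_def by blast
    qed
    have "False" if x: "\<And>n. x \<in> X closure_of U n (D n)" for x
    proof -
      have xX: "x \<in> topspace X"
        using x closure_of_subset_topspace by fastforce
      have "(x, h n) \<in> ?P closure_of H E Z" for n
      proof -
        have "(x, h n) \<in> ?P closure_of H (D n \<times> {h n}) Z"
          using x [of n] closure_of_slice_subset [OF continuous_map_Pair_const [OF h(1) [of n]], of X]
          unfolding U_def by blast
        then show ?thesis
          using closure_of_mono [OF mono [OF pair [OF D(1)] E DE subset_refl]] by blast
      qed
      then have inS: "h n \<in> {t \<in> topspace ?I. (x, t) \<in> ?P closure_of H E Z}" for n
        using h(1) by auto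
      \<comment> \<open>The heights at which the vertical line over \<open>x\<close> meets the
        closure of \<open>H E Z\<close> form a closed set of reals. It contains every
        \<open>h n\<close>, hence also their limit 0.\<close>
      have "continuous_map ?I ?P (\<lambda>t. (x, t))"
        using xX by (auto intro!: continuous_map_pairedI)
      then have "closedin ?I {t \<in> topspace ?I. (x, t) \<in> ?P closure_of H E Z}"
        by (rule closedin_continuous_map_preimage) simp
      then have "closed {t \<in> topspace ?I. (x, t) \<in> ?P closure_of H E Z}"
        using closedin_closed_trans closed_real_atLeastAtMost by blast
      then have "(x, 0) \<in> ?P closure_of H E Z"
        using closed_sequentially [OF _ inS h_lim] by simp
      then show False
        using H [OF E] xX unfolding Z_def by auto
    qed
    then show "(\<Inter>n. X closure_of U n (D n)) = {}"
      by auto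
  qed
qed

text \<open>If \<open>x\<close> were in every projection, the slices of the \<open>D i\<close> over
  \<open>x\<close> would be decreasing nonempty closed subsets of the compact space
  \<open>Y\<close>; a common point \<open>y\<close> would put \<open>(x, y)\<close> in every
  \<open>D i\<close>.\<close>

lemma decseq_fst_image_Inter_empty:
  assumes Y: "compact_space Y" and D: "\<And>i. closedin (prod_topology X Y) (D i)"
    and "decseq D" "(\<Inter>i. D i) = {}"
  shows "(\<Inter>i::nat. fst ` D i) = {}"
proof -
  have False if x: "\<And>i. x \<in> fst ` D i" for x
  proof -
    let ?C = "\<lambda>i. {y \<in> topspace Y. (x, y) \<in> D i}"
    have sub: "D i \<subseteq> topspace X \<times> topspace Y" for i
      using closedin_subset [OF D] by simp
    have "x \<in> topspace X"
      using x [of 0] sub [of 0] by auto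
    then have "continuous_map Y (prod_topology X Y) (\<lambda>y. (x, y))"
      by (auto intro!: continuous_map_pairedI)
    then have "closedin Y (?C i)" for i
      using D by (rule closedin_continuous_map_preimage)
    moreover have "?C i \<noteq> {}" for i
      using x [of i] sub [of i] by fastforce
    moreover have "decseq ?C"
      using \<open>decseq D\<close> unfolding decseq_def by blast
    ultimately have "(\<Inter>i. ?C i) \<noteq> {}"
      using compact_space_imp_nest [OF Y, of ?C] by blast
    then show False
      using assms(4) by blast
  qed
  then show ?thesis
    by blast
qed

lemma monotonically_countably_paracompact_space_Times_compact:
  assumes "monotonically_countably_paracompact_space X" and Y: "compact_space Y"
  shows "monotonically_countably_paracompact_space (prod_topology X Y)"
proof -
  let ?P = "prod_topology X Y"
  obtain U :: "nat \<Rightarrow> 'a set \<Rightarrow> 'a set" where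
    U: "\<forall>n D. closedin X D \<longrightarrow> openin X (U n D) \<and> D \<subseteq> U n D"
    and mono: "\<forall>n D E. closedin X D \<and> closedin X E \<and> E \<subseteq> D \<longrightarrow> U n E \<subseteq> U n D"
    and empty: "\<forall>D. (\<forall>i. closedin X (D i)) \<and> decseq D \<and> (\<Inter>i. D i) = {} \<longrightarrow>
           (\<Inter>n. X closure_of U n (D n)) = {}"
    using assms(1) unfolding monotonically_countably_paracompact_space_def by (elim exE conjE)
  have cl: "closedin X (fst ` D)" if "closedin ?P D" for D
    using closed_map_fst [OF Y] that unfolding closed_map_def by blast
  show ?thesis
    unfolding monotonically_countably_paracompact_space_def
  \<comment> \<open>Project to \<open>X\<close>, expand there, and take the full cylinder. Its
    closure is the cylinder over the closure, so an empty intersection in \<open>X\<close> gives an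
    empty one in the product.\<close>
  proof (intro exI [of _ "\<lambda>n D. U n (fst ` D) \<times> topspace Y"] conjI allI impI)
    fix n D assume D: "closedin ?P D"
    show "openin ?P (U n (fst ` D) \<times> topspace Y)"
      using U cl [OF D] by (simp add: openin_prod_Times_iff)
    show "D \<subseteq> U n (fst ` D) \<times> topspace Y"
      using U cl [OF D] closedin_subset [OF D] by fastforce
  next
    fix n D E assume "closedin ?P D \<and> closedin ?P E \<and> E \<subseteq> D"
    then have "U n (fst ` E) \<subseteq> U n (fst ` D)"
      using mono cl by (meson image_mono)
    then show "U n (fst ` E) \<times> topspace Y \<subseteq> U n (fst ` D) \<times> topspace Y"
      by auto
  next
    fix D :: "nat \<Rightarrow> ('a \<times> 'b) set"
    assume D: "(\<forall>i. closedin ?P (D i)) \<and> decseq D \<and> (\<Inter>i. D i) = {}"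
    have "decseq (\<lambda>i. fst ` D i)"
      using D unfolding decseq_def by blast
    then have "(\<Inter>n. X closure_of U n (fst ` D n)) = {}"
      using D cl decseq_fst_image_Inter_empty [OF Y, of X D] empty [rule_format, of "\<lambda>i. fst ` D i"]
      by blast
    then show "(\<Inter>n. ?P closure_of (U n (fst ` D n) \<times> topspace Y)) = {}"
      unfolding closure_of_Times by blast
  qed
qed

theorem theorem5:
  fixes X :: "'a topology"
  assumes "regular_space X" and "t1_space X"
    and "monotonically_delta_normal_space (prod_topology X (top_of_set {0..1::real}))"
  shows "monotonically_delta_normal_space X
       \<and> monotonically_countably_paracompact_space X
       \<and> monotonically_countably_paracompact_space (prod_topology X (top_of_set {0..1::real}))"
proof (intro conjI)
  show "monotonically_delta_normal_space X"
    \<comment> \<open>Any point of the interval could serve as the height of the slice.\<close>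
    using monotonically_delta_normal_space_factor [OF assms(3), of 0] by simp
  show X: "monotonically_countably_paracompact_space X"
    by (rule monotonically_countably_paracompact_space_if_delta_normal_Times_interval [OF assms(3)])
  show "monotonically_countably_paracompact_space (prod_topology X (top_of_set {0..1::real}))"
    by (rule monotonically_countably_paracompact_space_Times_compact [OF X])
      (simp add: compact_space_subtopology)
qed

end
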